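(* Let $\mathfrak{A}$ be a unital $C^*$-algebra and let $x,y\in\mathfrak{A}$. Then the following statements are equivalent: (i) $x$ is numerical radius parallel to $y$, i.e. $x\parallel_v y$. (ii) There exists a pure state $\varphi$ on $\mathfrak{A}$ such that $|\varphi(x)\varphi(y)| = v(x)v(y)$.
   Context: $\mathfrak{A}$ is a (nonzero, complex) $C^*$-algebra with unit $e$. The set of normalized states is $\mathcal{S}(\mathfrak{A})=\{\varphi\in\mathfrak{A}':\varphi(e)=\|\varphi\|=1\}$, where $\mathfrak{A}'$ is the dual space of $\mathfrak{A}$; pure states are the extreme points of $\mathcal{S}(\mathfrak{A})$ (equivalently, states $\varphi$ such that every positive functional $\psi$ with $\psi(a^*a)\le\varphi(a^*a)$ for all $a\in\mathfrak{A}$ is of the form $\mu\varphi$ with $0\le\mu\le1$). The numerical radius of $x$ is $v(x)=\sup\{|\varphi(x)|:\varphi\in\mathcal{S}(\mathfrak{A})\}$. An element $x\in\mathfrak{A}$ is numerical radius parallel to $y\in\mathfrak{A}$, written $x\parallel_v y$, if $v(x+\lambda y)=v(x)+v(y)$ for some $\lambda\in\mathbb{C}$ with $|\lambda|=1$. *)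

theory Defs
  imports "HOL-Analysis.Analysis"
begin

text \<open>
  Nonzero unital complex \<open>C\<^sup>*\<close>-algebras. The unit is \<open>1\<close>. The axiom \<open>norm 1 = 1\<close> inherited from
  \<^class>\<open>real_normed_algebra_1\<close> is no restriction: it follows from the \<open>C\<^sup>*\<close>-identity and
  \<open>0 \<noteq> 1\<close>. Real scalar multiplication is required to be the restriction of the complex one.
\<close>

class unital_cstar_algebra = banach + real_normed_algebra_1 +
  fixes scaleC :: "complex \<Rightarrow> 'a \<Rightarrow> 'a" (infixr \<open>*\<^sub>C\<close> 75)
    and star :: "'a \<Rightarrow> 'a"
  assumes scaleC_add_right: "c *\<^sub>C (x + y) = c *\<^sub>C x + c *\<^sub>C y"
    and scaleC_add_left: "(c + d) *\<^sub>C x = c *\<^sub>C x + d *\<^sub>C x"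
    and scaleC_scaleC: "c *\<^sub>C (d *\<^sub>C x) = (c * d) *\<^sub>C x"
    and scaleC_of_real: "complex_of_real r *\<^sub>C x = r *\<^sub>R x"
    and mult_scaleC_left: "(c *\<^sub>C x) * y = c *\<^sub>C (x * y)"
    and mult_scaleC_right: "x * (c *\<^sub>C y) = c *\<^sub>C (x * y)"
    and norm_scaleC: "norm (c *\<^sub>C x) = cmod c * norm x"
    and star_star: "star (star x) = x"
    and star_add: "star (x + y) = star x + star y"
    and star_scaleC: "star (c *\<^sub>C x) = cnj c *\<^sub>C star x"
    and star_mult: "star (x * y) = star y * star x"
    and norm_star_mult_self: "norm (star x * x) = (norm x)\<^sup>2"

instantiation complex :: unital_cstar_algebra
begin

definition scaleC_complex :: "complex \<Rightarrow> complex \<Rightarrow> complex"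
  where "scaleC_complex = (*)"

definition star_complex :: "complex \<Rightarrow> complex"
  where "star_complex = cnj"

instance
  by standard
    (simp_all add: scaleC_complex_def star_complex_def algebra_simps norm_mult
      power2_eq_square scaleR_conv_of_real)

end

text \<open>
  The type \<open>'a \<Rightarrow>\<^sub>L complex\<close> consists of the bounded real-linear maps, so
  complex homogeneity has to be imposed. Its norm is the operator norm, and its real vector space
  structure is the one used for the convexity notion \<^const>\<open>extreme_point_of\<close>.
\<close>

definition dual_space :: "('a::unital_cstar_algebra \<Rightarrow>\<^sub>L complex) set"
  where "dual_space = {\<phi>. \<forall>c a. blinfun_apply \<phi> (c *\<^sub>C a) = c * blinfun_apply \<phi> a}"

definition states :: "('a::unital_cstar_algebra \<Rightarrow>\<^sub>L complex) set"
  where "states = {\<phi> \<in> dual_space. blinfun_apply \<phi> 1 = 1 \<and> norm \<phi> = 1}"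

definition pure_state :: "('a::unital_cstar_algebra \<Rightarrow>\<^sub>L complex) \<Rightarrow> bool"
  where "pure_state \<phi> \<longleftrightarrow> \<phi> extreme_point_of states"

definition numerical_radius :: "'a::unital_cstar_algebra \<Rightarrow> real"
  where "numerical_radius x = (SUP \<phi>\<in>states. cmod (blinfun_apply \<phi> x))"

definition numerical_radius_parallel :: "'a::unital_cstar_algebra \<Rightarrow> 'a \<Rightarrow> bool"
    (infix \<open>\<parallel>\<^sub>v\<close> 50)
  where "x \<parallel>\<^sub>v y \<longleftrightarrow>
    (\<exists>c. cmod c = 1 \<and> numerical_radius (x + c *\<^sub>C y) = numerical_radius x + numerical_radius y)"

end

theory Submission
  imports Defs
begin

text \<open>
  The key fact is that pure states attain the numerical radius. Real parts of states are exactly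
  the real-linear functionals below the sublinear functional
  \<open>p a = (INF t\<in>{0..}. norm (a + t *\<^sub>R 1) - t)\<close>. The largest sublinear functional
  below \<open>q\<close> with value \<open>- q z\<close> at \<open>- z\<close> cuts out the face of those functionals below \<open>q\<close> that take
  the value \<open>q z\<close> at \<open>z\<close>, and infima of chains cut out faces too; a sublinear functional minimal
  under these operations is linear and extreme. One application of Zorn's lemma thus replaces
  the Hahn-Banach, Banach-Alaoglu and Krein-Milman theorems.
\<close>

section \<open>Extreme linear functionals below a sublinear functional\<close>

definition sublinear :: "('a::real_vector \<Rightarrow> real) \<Rightarrow> bool"
  where "sublinear q \<longleftrightarrow> (\<forall>a b. q (a + b) \<le> q a + q b) \<and> (\<forall>t\<ge>0. \<forall>a. q (t *\<^sub>R a) = t * q a)"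

lemma sublinear_add: "sublinear q \<Longrightarrow> q (a + b) \<le> q a + q b"
  and sublinear_scaleR: "sublinear q \<Longrightarrow> t \<ge> 0 \<Longrightarrow> q (t *\<^sub>R a) = t * q a"
  by (auto simp: sublinear_def)

lemma sublinear_0: "sublinear q \<Longrightarrow> q 0 = 0"
  using sublinear_scaleR[of q 0 0] by simp

lemma sublinear_minus: "sublinear q \<Longrightarrow> - q (- a) \<le> q a"
  using sublinear_add[of q a "- a"] sublinear_0[of q] by simp

text \<open>Applying the inequality to \<open>inverse t\<close> and \<open>t *\<^sub>R a\<close>
  yields the reverse one. For infima only this one direction then has to be checked.\<close>

lemma sublinearI:
  fixes q :: "'a::real_vector \<Rightarrow> real"
  assumes "\<And>a b. q (a + b) \<le> q a + q b" and "q 0 = 0"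
    and le: "\<And>t a. t > 0 \<Longrightarrow> q (t *\<^sub>R a) \<le> t * q a"
  shows "sublinear q"
proof -
  have "q (t *\<^sub>R a) = t * q a" if "t \<ge> 0" for t a
  proof (cases "t = 0")
    case False
    with that have t: "t > 0" by simp
    have "q a \<le> inverse t * q (t *\<^sub>R a)"
      using le[of "inverse t" "t *\<^sub>R a"] t by simp
    then have "t * q a \<le> q (t *\<^sub>R a)"
      using t by (simp add: field_simps)
    with le[OF t, of a] show ?thesis by simp
  qed (use assms(2) in simp)
  with assms(1) show ?thesis by (simp add: sublinear_def)
qed

text \<open>By oddness, subadditivity at \<open>- a\<close> and \<open>- b\<close> is
  superadditivity at \<open>a\<close> and \<open>b\<close>.\<close>

lemma sublinear_odd_imp_linear:
  assumes q: "sublinear q" and odd: "\<And>a. q (- a) = - q a"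
  shows "linear q"
proof (rule linearI)
  fix a b
  show "q (a + b) = q a + q b"
    using sublinear_add[OF q, of a b] sublinear_add[OF q, of "- a" "- b"] odd[of "a + b"]
      odd[of a] odd[of b] by simp
next
  fix t a
  show "q (t *\<^sub>R a) = t *\<^sub>R q a"
  proof (cases "t \<ge> 0")
    case False
    then show ?thesis
      using sublinear_scaleR[OF q, of "- t" a] odd[of "t *\<^sub>R a"] by simp
  qed (simp add: sublinear_scaleR[OF q])
qed

text \<open>For sublinear \<open>q\<close> this is the one-sided directional derivative of
  \<open>q\<close> at \<open>z\<close> in direction \<open>a\<close>: the term for
  \<open>t > 0\<close> is the difference quotient with step \<open>1 / t\<close>.\<close>

definition reduce :: "('a::real_vector \<Rightarrow> real) \<Rightarrow> 'a \<Rightarrow> 'a \<Rightarrow> real"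
  where "reduce q z a = (INF t\<in>{0..}. q (a + t *\<^sub>R z) - t * q z)"

lemma
  assumes q: "sublinear q"
  shows reduce_lower: "t \<ge> 0 \<Longrightarrow> reduce q z a \<le> q (a + t *\<^sub>R z) - t * q z"
    and reduce_greatest: "(\<And>t. t \<ge> 0 \<Longrightarrow> r \<le> q (a + t *\<^sub>R z) - t * q z) \<Longrightarrow> r \<le> reduce q z a"
proof -
  \<comment> \<open>Writing \<open>t *\<^sub>R z\<close> as the sum of
    \<open>a + t *\<^sub>R z\<close> and \<open>- a\<close> bounds all terms below, so that the real
    infimum is a genuine one.\<close>
  have "- q (- a) \<le> q (a + t *\<^sub>R z) - t * q z" if "t \<ge> 0" for t
    using sublinear_add[OF q, of "a + t *\<^sub>R z" "- a"] sublinear_scaleR[OF q that, of z] by simp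
  then have "bdd_below ((\<lambda>t. q (a + t *\<^sub>R z) - t * q z) ` {0..})"
    by (intro bdd_belowI2) auto
  then show "t \<ge> 0 \<Longrightarrow> reduce q z a \<le> q (a + t *\<^sub>R z) - t * q z"
    unfolding reduce_def by (intro cINF_lower) auto
  show "(\<And>t. t \<ge> 0 \<Longrightarrow> r \<le> q (a + t *\<^sub>R z) - t * q z) \<Longrightarrow> r \<le> reduce q z a"
    unfolding reduce_def by (intro cINF_greatest) auto
qed

lemma reduce_le: "sublinear q \<Longrightarrow> reduce q z \<le> q"
  using reduce_lower[of q 0] by (simp add: le_fun_def)

lemma reduce_minus_le: "sublinear q \<Longrightarrow> reduce q z (- z) \<le> - q z"
  using reduce_lower[of q 1 z "- z"] sublinear_0[of q] by simp

lemma sublinear_reduce: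
  assumes q: "sublinear q"
  shows "sublinear (reduce q z)"
proof (rule sublinearI)
  fix a b
  \<comment> \<open>Parameters \<open>s\<close> for \<open>a\<close> and \<open>t\<close> for
    \<open>b\<close> combine to \<open>s + t\<close> for \<open>a + b\<close>; the two infima are
    then taken one after the other.\<close>
  have "reduce q z (a + b) - (q (b + t *\<^sub>R z) - t * q z) \<le> q (a + s *\<^sub>R z) - s * q z"
    if "s \<ge> 0" "t \<ge> 0" for s t
    using reduce_lower[OF q, of "s + t" z "a + b"] that
      sublinear_add[OF q, of "a + s *\<^sub>R z" "b + t *\<^sub>R z"]
    by (simp add: algebra_simps)
  then have "reduce q z (a + b) - (q (b + t *\<^sub>R z) - t * q z) \<le> reduce q z a" if "t \<ge> 0" for t
    using that by (intro reduce_greatest[OF q])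
  then have "reduce q z (a + b) - reduce q z a \<le> q (b + t *\<^sub>R z) - t * q z" if "t \<ge> 0" for t
    using that by (simp add: algebra_simps)
  then have "reduce q z (a + b) - reduce q z a \<le> reduce q z b"
    by (intro reduce_greatest[OF q])
  then show "reduce q z (a + b) \<le> reduce q z a + reduce q z b" by simp
next
  have "0 \<le> reduce q z 0"
    using sublinear_scaleR[OF q] by (intro reduce_greatest[OF q]) simp
  with reduce_lower[OF q, of 0 z 0] sublinear_0[OF q] show "reduce q z 0 = 0" by simp
next
  fix c :: real and a
  assume c: "c > 0"
  have "reduce q z (c *\<^sub>R a) / c \<le> q (a + t *\<^sub>R z) - t * q z" if "t \<ge> 0" for t
  proof -
    \<comment> \<open>Scaling \<open>a\<close> by \<open>c\<close> amounts to replacing the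
      parameter \<open>t\<close> by \<open>c * t\<close>.\<close>
    have "c *\<^sub>R a + (c * t) *\<^sub>R z = c *\<^sub>R (a + t *\<^sub>R z)"
      by (simp add: algebra_simps)
    then have "reduce q z (c *\<^sub>R a) \<le> c * (q (a + t *\<^sub>R z) - t * q z)"
      using reduce_lower[OF q, of "c * t" z "c *\<^sub>R a"] c that
        sublinear_scaleR[OF q, of c "a + t *\<^sub>R z"] by (simp add: algebra_simps)
    then show ?thesis using c by (simp add: field_simps)
  qed
  then have "reduce q z (c *\<^sub>R a) / c \<le> reduce q z a"
    by (intro reduce_greatest[OF q])
  then show "reduce q z (c *\<^sub>R a) \<le> c * reduce q z a"
    using c by (simp add: field_simps)
qed

text \<open>The bound at \<open>- z\<close> forces \<open>f z \<ge> q z\<close> by linearity.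
  Conversely \<open>f a = f (a + t *\<^sub>R z) - t * f z\<close>, and both terms are controlled by
  \<open>q\<close>. Thus \<open>reduce q z\<close> describes the face exposed by
  \<open>z\<close>.\<close>

lemma linear_le_reduce_iff:
  assumes q: "sublinear q" and f: "linear f"
  shows "f \<le> reduce q z \<longleftrightarrow> f \<le> q \<and> f z = q z"
proof
  assume le: "f \<le> reduce q z"
  then have "f \<le> q" using reduce_le[OF q] by (rule order_trans)
  moreover have "f (- z) \<le> - q z"
    using le_funD[OF le, of "- z"] reduce_minus_le[OF q, of z] by simp
  ultimately show "f \<le> q \<and> f z = q z"
    using linear_neg[OF f, of z] by (force simp: le_fun_def intro: antisym)
next
  assume f_le: "f \<le> q \<and> f z = q z"
  have "f a \<le> q (a + t *\<^sub>R z) - t * q z" for a t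
    using f_le le_funD[of f q "a + t *\<^sub>R z"] linear_add[OF f] linear_scale[OF f] by simp
  then show "f \<le> reduce q z"
    by (intro le_funI reduce_greatest[OF q])
qed

text \<open>For \<open>q \<le> p\<close> this says that the linear functionals below
  \<open>q\<close> form a face of the convex set of those below \<open>p\<close>. Faces are encoded
  by their bounding functionals, so that intersecting a chain of faces becomes a pointwise
  infimum.\<close>

definition facial :: "('a::real_vector \<Rightarrow> real) \<Rightarrow> ('a \<Rightarrow> real) \<Rightarrow> bool"
  where "facial p q \<longleftrightarrow> (\<forall>g h u. linear g \<longrightarrow> linear h \<longrightarrow> g \<le> p \<longrightarrow> h \<le> p \<longrightarrow> 0 < u \<longrightarrow> u < 1 \<longrightarrow>
    (\<lambda>a. (1 - u) * g a + u * h a) \<le> q \<longrightarrow> g \<le> q \<and> h \<le> q)"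

lemma facialD:
  assumes "facial p q" "linear g" "linear h" "g \<le> p" "h \<le> p" "0 < u" "u < 1"
    and "(\<lambda>a. (1 - u) * g a + u * h a) \<le> q"
  shows "g \<le> q" "h \<le> q"
  using assms unfolding facial_def by blast+

lemma facial_reduce:
  assumes q: "sublinear q" and fac: "facial p q"
  shows "facial p (reduce q z)"
  unfolding facial_def
proof (intro allI impI)
  fix g h :: "'a \<Rightarrow> real" and u :: real
  assume lin: "linear g" "linear h" and "g \<le> p" "h \<le> p" and u: "0 < u" "u < 1"
    and le: "(\<lambda>a. (1 - u) * g a + u * h a) \<le> reduce q z"
  have "linear (\<lambda>a. (1 - u) * g a + u * h a)"
    using linear_compose_scale_right[OF lin(1), of "1 - u"]
      linear_compose_scale_right[OF lin(2), of u] linear_compose_add by fastforce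
  then have comb: "(\<lambda>a. (1 - u) * g a + u * h a) \<le> q" and eq: "(1 - u) * g z + u * h z = q z"
    using le linear_le_reduce_iff[OF q] by blast+
  have le_q: "g \<le> q" "h \<le> q"
    using facialD[OF fac lin \<open>g \<le> p\<close> \<open>h \<le> p\<close> u comb] by auto
  then have gz: "g z \<le> q z" and hz: "h z \<le> q z" by (auto simp: le_fun_def)
  \<comment> \<open>Both gaps are nonnegative with positive weights, so a vanishing weighted sum
    makes each of them zero.\<close>
  have "(1 - u) * (q z - g z) + u * (q z - h z) = 0"
    using eq by (simp add: algebra_simps)
  moreover have "(1 - u) * (q z - g z) \<ge> 0" "u * (q z - h z) \<ge> 0"
    using gz hz u by simp_all
  ultimately have "(1 - u) * (q z - g z) = 0" "u * (q z - h z) = 0" by linarith+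
  then have "g z = q z" "h z = q z" using u by simp_all
  with le_q show "g \<le> reduce q z \<and> h \<le> reduce q z"
    using linear_le_reduce_iff[OF q] lin by blast
qed

section \<open>Infima of chains and minimal facial functionals\<close>

lemma chain_Inf_facial:
  fixes p :: "'a::real_vector \<Rightarrow> real"
  assumes ne: "C \<noteq> {}" and chain: "\<And>q r. q \<in> C \<Longrightarrow> r \<in> C \<Longrightarrow> q \<le> r \<or> r \<le> q"
    and sub: "\<And>q. q \<in> C \<Longrightarrow> sublinear q" and below: "\<And>q. q \<in> C \<Longrightarrow> q \<le> p"
    and fac: "\<And>q. q \<in> C \<Longrightarrow> facial p' q"
  defines "m \<equiv> \<lambda>a. INF q\<in>C. q a"
  shows "sublinear m" "\<And>q. q \<in> C \<Longrightarrow> m \<le> q" "facial p' m"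
proof -
  \<comment> \<open>The common upper bound \<open>p\<close> also yields a common lower bound, which
    makes the infimum finite.\<close>
  have "- p (- a) \<le> q a" if "q \<in> C" for q a
    using sublinear_minus[OF sub[OF that], of a] le_funD[OF below[OF that], of "- a"] by simp
  then have bdd: "bdd_below ((\<lambda>q. q a) ` C)" for a
    by (intro bdd_belowI2) auto
  show low: "m \<le> q" if "q \<in> C" for q
    unfolding m_def by (intro le_funI cINF_lower bdd that)
  have great: "r \<le> m a" if "\<And>q. q \<in> C \<Longrightarrow> r \<le> q a" for r a
    unfolding m_def by (intro cINF_greatest ne that)
  show "sublinear m"
  proof (rule sublinearI)
    fix a b
    have "m (a + b) - r b \<le> q a" if qr: "q \<in> C" "r \<in> C" for q r
    proof -
      \<comment> \<open>The chain property enters here: the smaller of \<open>q\<close> and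
        \<open>r\<close> serves both summands, whereas an infimum of arbitrary sublinear functionals
        need not be subadditive.\<close>
      obtain s where s: "s \<in> C" "s \<le> q" "s \<le> r"
        using chain[OF qr] qr by blast
      then show ?thesis
        using sublinear_add[OF sub[OF s(1)], of a b] le_funD[OF low[OF s(1)], of "a + b"]
          le_funD[OF s(2), of a] le_funD[OF s(3), of b] by linarith
    qed
    then have "m (a + b) - r b \<le> m a" if "r \<in> C" for r
      using that by (intro great)
    then have "m (a + b) - m a \<le> r b" if "r \<in> C" for r
      using that by (simp add: diff_le_eq add.commute[of "r b"])
    then have "m (a + b) - m a \<le> m b" by (intro great)
    then show "m (a + b) \<le> m a + m b" by simp
  next
    have "(\<lambda>q. q 0) ` C = {0}" using ne sublinear_0[OF sub] by force
    then show "m 0 = 0" by (simp add: m_def)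
  next
    fix t :: real and a
    assume t: "t > 0"
    have "m (t *\<^sub>R a) / t \<le> q a" if "q \<in> C" for q
      using le_funD[OF low[OF that], of "t *\<^sub>R a"] sublinear_scaleR[OF sub[OF that], of t a] t
      by (simp add: field_simps)
    then have "m (t *\<^sub>R a) / t \<le> m a" by (intro great)
    then show "m (t *\<^sub>R a) \<le> t * m a" using t by (simp add: field_simps)
  qed
  show "facial p' m"
    unfolding facial_def
  proof (intro allI impI)
    fix g h :: "'a \<Rightarrow> real" and u :: real
    assume *: "linear g" "linear h" "g \<le> p'" "h \<le> p'" "0 < u" "u < 1"
      and le: "(\<lambda>a. (1 - u) * g a + u * h a) \<le> m"
    have "g \<le> q \<and> h \<le> q" if "q \<in> C" for q
      using facialD[OF fac[OF that] * order_trans[OF le low[OF that]]] by simp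
    then show "g \<le> m \<and> h \<le> m"
      by (auto simp: le_fun_def intro!: great)
  qed
qed

text \<open>Zorn's lemma for the reversed pointwise order: a nonempty chain is bounded by its
  infimum, the empty one by \<open>p\<close>. The starting functional \<open>p\<close> and the
  ambient \<open>p'\<close> are separate because the search will start at a reduction of the ambient
  functional.\<close>

lemma minimal_facial:
  fixes p :: "'a::real_vector \<Rightarrow> real"
  assumes "sublinear p" "facial p' p"
  obtains m where "sublinear m" "m \<le> p" "facial p' m"
    "\<And>q. sublinear q \<Longrightarrow> facial p' q \<Longrightarrow> q \<le> m \<Longrightarrow> q = m"
proof -
  define A where "A = {q. sublinear q \<and> q \<le> p \<and> facial p' q}"
  have "\<exists>m\<in>A. \<forall>q\<in>A. q \<le> m \<longrightarrow> q = m"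
  proof (rule predicate_Zorn)
    show "partial_order_on A (relation_of (\<lambda>q r. r \<le> q) A)"
      by (rule partial_order_on_relation_ofI) auto
  next
    fix C
    assume C: "C \<in> Chains (relation_of (\<lambda>q r. r \<le> q) A)"
    have CA: "C \<subseteq> A" and chain: "\<And>q r. q \<in> C \<Longrightarrow> r \<in> C \<Longrightarrow> q \<le> r \<or> r \<le> q"
      using C by (auto simp: Chains_def relation_of_def)
    show "\<exists>u\<in>A. \<forall>q\<in>C. u \<le> q"
    proof (cases "C = {}")
      case True
      with assms show ?thesis by (auto simp: A_def)
    next
      case False
      have sub: "\<And>q. q \<in> C \<Longrightarrow> sublinear q" and below: "\<And>q. q \<in> C \<Longrightarrow> q \<le> p"
        and fac: "\<And>q. q \<in> C \<Longrightarrow> facial p' q"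
        using CA by (auto simp: A_def)
      let ?m = "\<lambda>a. INF q\<in>C. q a"
      have "sublinear ?m" "facial p' ?m" and low: "\<And>q. q \<in> C \<Longrightarrow> ?m \<le> q"
        using chain_Inf_facial[of C p p', OF False] chain sub below fac by blast+
      moreover have "?m \<le> p"
        using False low below by (meson ex_in_conv order_trans)
      ultimately show ?thesis
        by (intro bexI[of _ ?m]) (auto simp: A_def)
    qed
  qed
  then show ?thesis
    using that unfolding A_def by (metis (mono_tags, lifting) mem_Collect_eq order_trans)
qed

text \<open>Starting at \<open>reduce p z\<close> builds in the value \<open>p z\<close> at
  \<open>z\<close>. A minimal facial functional below it turns out to be linear, and its face is
  then the single point \<open>m\<close>, which is therefore extreme.\<close>

theorem extreme_linear_attaining:
  fixes p :: "'a::real_vector \<Rightarrow> real"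
  assumes p: "sublinear p"
  obtains f where "linear f" "f \<le> p" "f z = p z"
    "\<And>g h u. linear g \<Longrightarrow> linear h \<Longrightarrow> g \<le> p \<Longrightarrow> h \<le> p \<Longrightarrow> 0 < u \<Longrightarrow> u < 1 \<Longrightarrow>
      f = (\<lambda>a. (1 - u) * g a + u * h a) \<Longrightarrow> g = f \<and> h = f"
proof -
  have "facial p p" by (simp add: facial_def)
  then obtain m where m: "sublinear m" "m \<le> reduce p z" "facial p m"
    and min: "\<And>q. sublinear q \<Longrightarrow> facial p q \<Longrightarrow> q \<le> m \<Longrightarrow> q = m"
    using minimal_facial[OF sublinear_reduce[OF p] facial_reduce[OF p]] by metis
  \<comment> \<open>Every further reduction stays facial and below \<open>m\<close>, so minimality
    makes it trivial; the bound at \<open>- w\<close> then says that \<open>m\<close> is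
    odd.\<close>
  have "reduce m w = m" for w
    by (intro min sublinear_reduce facial_reduce reduce_le m)
  then have "m (- w) = - m w" for w
    using reduce_minus_le[OF m(1), of w] sublinear_minus[OF m(1), of w] by simp
  then have lin: "linear m"
    by (intro sublinear_odd_imp_linear m)
  have le_eq: "g = m" if "linear g" "g \<le> m" for g
  proof
    fix a
    show "g a = m a"
      using le_funD[OF that(2), of a] le_funD[OF that(2), of "- a"]
        linear_neg[OF lin, of a] linear_neg[OF that(1), of a] by simp
  qed
  show ?thesis
  proof
    show "linear m" by fact
    show "m \<le> p" "m z = p z" using linear_le_reduce_iff[OF p lin] m(2) by auto
    show "g = m \<and> h = m" if "linear g" "linear h" "g \<le> p" "h \<le> p" "0 < u" "u < 1"
      "m = (\<lambda>a. (1 - u) * g a + u * h a)" for g h u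
      using facialD[OF m(3) that(1-6)] le_eq that by auto
  qed
qed

section \<open>States and their real parts\<close>

lemma sublinear_norm: "sublinear (norm :: 'a::real_normed_vector \<Rightarrow> real)"
  by (simp add: sublinear_def norm_triangle_ineq)

lemma unimodular_rotation: "\<exists>c. cmod c = 1 \<and> c * w = of_real (cmod w)"
proof (cases "w = 0")
  case True
  then show ?thesis by (intro exI[of _ 1]) simp
next
  case False
  then show ?thesis
    by (intro exI[of _ "cnj (sgn w)"])
      (simp add: norm_divide sgn_eq complex_norm_square[symmetric] power2_eq_square field_simps)
qed

lemma minus_one_scaleC: "(- 1) *\<^sub>C a = - (a :: 'a::unital_cstar_algebra)"
  using scaleC_of_real[of "- 1" a] by simp

lemma state_scaleC: "\<phi> \<in> states \<Longrightarrow> blinfun_apply \<phi> (c *\<^sub>C a) = c * blinfun_apply \<phi> a"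
  by (simp add: states_def dual_space_def)

lemma state_cmod_le: "\<phi> \<in> states \<Longrightarrow> cmod (blinfun_apply \<phi> a) \<le> norm a"
  using norm_blinfun[of \<phi> a] by (simp add: states_def)

lemma cmod_state_le_numerical_radius:
  "\<phi> \<in> states \<Longrightarrow> cmod (blinfun_apply \<phi> a) \<le> numerical_radius a"
  unfolding numerical_radius_def
  by (intro cSUP_upper bdd_aboveI2[where M = "norm a"]) (auto simp: state_cmod_le)

lemma linear_Re_blinfun: "linear (\<lambda>a. Re (blinfun_apply \<phi> a))"
  by (intro linearI) (simp_all add: blinfun.add_right blinfun.scaleR_right)

text \<open>As \<open>norm 1 = 1\<close>, a linear functional lies below
  \<open>reduce norm 1\<close> exactly if it is at most the norm and takes the value 1 at the
  unit.\<close>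

lemma Re_state_le:
  fixes \<phi> :: "'a::unital_cstar_algebra \<Rightarrow>\<^sub>L complex"
  assumes "\<phi> \<in> states"
  shows "(\<lambda>a. Re (blinfun_apply \<phi> a)) \<le> reduce norm 1"
  unfolding linear_le_reduce_iff[OF sublinear_norm linear_Re_blinfun]
  using assms order_trans[OF complex_Re_le_cmod state_cmod_le[OF assms]]
  by (auto simp: le_fun_def states_def)

text \<open>Complex homogeneity recovers the imaginary part at \<open>a\<close> as minus the real
  part at \<open>\<i> *\<^sub>C a\<close>.\<close>

lemma state_eqI:
  assumes "\<phi> \<in> states" "\<psi> \<in> states" "\<And>a. Re (blinfun_apply \<phi> a) = Re (blinfun_apply \<psi> a)"
  shows "\<phi> = \<psi>"
proof (rule blinfun_eqI, rule complex_eqI)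
  fix a
  show "Im (blinfun_apply \<phi> a) = Im (blinfun_apply \<psi> a)"
    using assms(3)[of "\<i> *\<^sub>C a"] by (simp add: state_scaleC assms(1,2))
qed (rule assms(3))

text \<open>The usual complexification of a real functional,
  \<open>f a - \<i> * f (\<i> *\<^sub>C a)\<close>, is complex linear with real part
  \<open>f\<close>.\<close>

lemma state_of_Re:
  fixes f :: "'a::unital_cstar_algebra \<Rightarrow> real"
  assumes lin: "linear f" and le: "f \<le> reduce norm 1"
  obtains \<phi> where "\<phi> \<in> states" "\<And>a. Re (blinfun_apply \<phi> a) = f a"
proof -
  have f_le: "\<And>a. f a \<le> norm a" and f1: "f 1 = 1"
    using le unfolding linear_le_reduce_iff[OF sublinear_norm lin] by (auto simp: le_fun_def)
  define F where "F a = Complex (f a) (- f (\<i> *\<^sub>C a))" for a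
  have F_add: "F (a + b) = F a + F b" for a b
    by (simp add: F_def linear_add[OF lin] scaleC_add_right complex_eq_iff)
  have F_real: "F (of_real r *\<^sub>C a) = of_real r * F a" for r a
  proof -
    have "\<i> *\<^sub>C (r *\<^sub>R a) = r *\<^sub>R (\<i> *\<^sub>C a)"
      by (simp add: scaleC_scaleC mult.commute flip: scaleC_of_real)
    then show ?thesis
      by (simp add: F_def scaleC_of_real linear_scale[OF lin] complex_eq_iff)
  qed
  have F_i: "F (\<i> *\<^sub>C a) = \<i> * F a" for a
    by (simp add: F_def scaleC_scaleC minus_one_scaleC linear_neg[OF lin] complex_eq_iff)
  have F_scale: "F (c *\<^sub>C a) = c * F a" for c a
  proof -
    have "c *\<^sub>C a = of_real (Re c) *\<^sub>C a + \<i> *\<^sub>C (of_real (Im c) *\<^sub>C a)"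
      by (simp add: scaleC_scaleC flip: scaleC_add_left complex_eq)
    then have "F (c *\<^sub>C a) = (of_real (Re c) + \<i> * of_real (Im c)) * F a"
      by (simp only: F_add F_real F_i) (simp add: algebra_simps)
    then show ?thesis by (simp flip: complex_eq)
  qed
  have F_norm: "cmod (F a) \<le> norm a" for a
  proof -
    \<comment> \<open>Rotating \<open>a\<close> makes the value of \<open>F\<close> real and
      nonnegative, so the bound on \<open>f\<close> alone controls the modulus of
      \<open>F\<close>.\<close>
    obtain c where c: "cmod c = 1" "c * F a = of_real (cmod (F a))"
      using unimodular_rotation by blast
    have "cmod (F a) = Re (F (c *\<^sub>C a))" by (simp add: F_scale c(2))
    also have "\<dots> \<le> norm (c *\<^sub>C a)" by (simp add: F_def f_le)
    finally show ?thesis by (simp add: norm_scaleC c(1))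
  qed
  have "bounded_linear F"
  proof (rule bounded_linear_intro[where K = 1])
    show "F (r *\<^sub>R a) = r *\<^sub>R F a" for r a
      using F_real[of r a] by (simp add: scaleC_of_real scaleR_conv_of_real)
  qed (simp_all add: F_add F_norm)
  then have app: "blinfun_apply (Blinfun F) = F" by (rule bounded_linear_Blinfun_apply)
  \<comment> \<open>Real part 1 and modulus at most 1 leave no room for an imaginary part.\<close>
  have "Re (F 1) = 1" by (simp add: F_def f1)
  moreover have "cmod (F 1) \<le> 1" using F_norm[of 1] by simp
  then have "(Re (F 1))\<^sup>2 + (Im (F 1))\<^sup>2 \<le> 1" by (simp add: cmod_def)
  ultimately have F1: "F 1 = 1" by (simp add: complex_eq_iff)
  have "norm (Blinfun F) \<le> 1"
    by (intro norm_blinfun_bound) (simp_all add: app F_norm)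
  moreover have "norm (Blinfun F) \<ge> 1"
    using norm_blinfun[of "Blinfun F" 1] by (simp add: app F1)
  ultimately have "Blinfun F \<in> states"
    by (simp add: states_def dual_space_def app F_scale F1)
  then show ?thesis using that by (simp add: app F_def)
qed

text \<open>Taking real parts turns a convex decomposition of a state into one of \<open>f\<close>.
  Extremality of \<open>f\<close> makes the real parts of the two endpoints agree, and states with
  equal real parts coincide.\<close>

lemma pure_state_attaining:
  fixes a :: "'a::unital_cstar_algebra"
  obtains \<phi> where "pure_state \<phi>" "Re (blinfun_apply \<phi> a) = reduce norm 1 a"
proof -
  let ?p = "reduce norm (1::'a)"
  obtain f where f: "linear f" "f \<le> ?p" "f a = ?p a"
    and ext: "\<And>g h u. linear g \<Longrightarrow> linear h \<Longrightarrow> g \<le> ?p \<Longrightarrow> h \<le> ?p \<Longrightarrow> 0 < u \<Longrightarrow> u < 1 \<Longrightarrow>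
      f = (\<lambda>a. (1 - u) * g a + u * h a) \<Longrightarrow> g = f \<and> h = f"
    by (rule extreme_linear_attaining[OF sublinear_reduce[OF sublinear_norm, of 1], of a]) (rule that; blast)
  obtain \<phi> where \<phi>: "\<phi> \<in> states" "\<And>a. Re (blinfun_apply \<phi> a) = f a"
    using state_of_Re[OF f(1,2)] by blast
  have "\<phi> \<notin> open_segment \<psi> \<eta>" if st: "\<psi> \<in> states" "\<eta> \<in> states" for \<psi> \<eta>
  proof
    assume "\<phi> \<in> open_segment \<psi> \<eta>"
    then obtain u where ne: "\<psi> \<noteq> \<eta>" and u: "0 < u" "u < 1"
      and eq: "\<phi> = (1 - u) *\<^sub>R \<psi> + u *\<^sub>R \<eta>"
      by (auto simp: in_segment)
    have "f = (\<lambda>a. (1 - u) * Re (blinfun_apply \<psi> a) + u * Re (blinfun_apply \<eta> a))"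
      unfolding \<phi>(2)[symmetric] eq by (simp add: blinfun.add_left blinfun.scaleR_left)
    from ext[OF linear_Re_blinfun linear_Re_blinfun Re_state_le[OF st(1)] Re_state_le[OF st(2)] u this]
    have "Re (blinfun_apply \<psi> a) = Re (blinfun_apply \<eta> a)" for a
      by (metis (full_types))
    with state_eqI st ne show False by blast
  qed
  with \<phi>(1) have "pure_state \<phi>"
    by (simp add: pure_state_def extreme_point_of_def)
  then show ?thesis
    using \<phi>(2) f(3) that by simp
qed

section \<open>From real parts to moduli: rotations and compactness of the circle\<close>

lemma continuous_on_gauge_scaleC:
  fixes w :: "'a::unital_cstar_algebra"
  shows "continuous_on S (\<lambda>c. reduce norm 1 (c *\<^sub>C w))"
proof -
  let ?p = "reduce norm (1::'a)"
  have p: "sublinear ?p" by (intro sublinear_reduce sublinear_norm)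
  \<comment> \<open>A sublinear functional below the norm is 1-Lipschitz.\<close>
  have diff: "?p a - ?p b \<le> norm (a - b)" for a b
    using sublinear_add[OF p, of "a - b" b] le_funD[OF reduce_le[OF sublinear_norm], of 1 "a - b"]
    by simp
  have scale: "norm (c *\<^sub>C w - d *\<^sub>C w) = norm w * dist c d" for c d
  proof -
    have "c *\<^sub>C w - d *\<^sub>C w = (c - d) *\<^sub>C w"
      using scaleC_add_left[of "c - d" d w] by (simp add: algebra_simps)
    then show ?thesis by (simp add: norm_scaleC dist_norm)
  qed
  have "(norm w)-lipschitz_on S (\<lambda>c. ?p (c *\<^sub>C w))"
  proof (rule lipschitz_onI)
    fix c d
    show "dist (?p (c *\<^sub>C w)) (?p (d *\<^sub>C w)) \<le> norm w * dist c d"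
      using diff[of "c *\<^sub>C w" "d *\<^sub>C w"] diff[of "d *\<^sub>C w" "c *\<^sub>C w"] scale[of c d] scale[of d c]
      by (simp add: dist_real_def abs_le_iff dist_commute)
  qed simp
  then show ?thesis by (rule lipschitz_on_continuous_on)
qed

text \<open>The modulus of a state at \<open>w\<close> is its real part at a suitable rotation of
  \<open>w\<close>. The gauge \<open>reduce norm 1\<close> has a maximum over all rotations by
  compactness, and a pure state attaining the gauge at the best rotation beats every state.\<close>

theorem pure_state_attains_numerical_radius:
  fixes w :: "'a::unital_cstar_algebra"
  obtains \<phi> where "pure_state \<phi>" "cmod (blinfun_apply \<phi> w) = numerical_radius w"
proof -
  let ?p = "reduce norm (1::'a)"
  obtain c where c: "cmod c = 1" and max: "\<And>d. cmod d = 1 \<Longrightarrow> ?p (d *\<^sub>C w) \<le> ?p (c *\<^sub>C w)"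
    using continuous_attains_sup[OF compact_sphere _ continuous_on_gauge_scaleC, of "0 :: complex" 1 w]
    by auto
  obtain \<phi> where pure: "pure_state \<phi>" and \<phi>: "Re (blinfun_apply \<phi> (c *\<^sub>C w)) = ?p (c *\<^sub>C w)"
    using pure_state_attaining by blast
  from pure have st: "\<phi> \<in> states" by (simp add: pure_state_def extreme_point_of_def)
  have "cmod (blinfun_apply \<psi> w) \<le> cmod (blinfun_apply \<phi> w)" if "\<psi> \<in> states" for \<psi>
  proof -
    obtain d where d: "cmod d = 1" "d * blinfun_apply \<psi> w = of_real (cmod (blinfun_apply \<psi> w))"
      using unimodular_rotation by blast
    have "cmod (blinfun_apply \<psi> w) = Re (blinfun_apply \<psi> (d *\<^sub>C w))"
      by (simp add: state_scaleC that d(2))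
    also have "\<dots> \<le> ?p (d *\<^sub>C w)"
      using Re_state_le[OF that] by (simp add: le_fun_def)
    also have "\<dots> \<le> ?p (c *\<^sub>C w)" by (rule max[OF d(1)])
    also have "\<dots> \<le> cmod (blinfun_apply \<phi> (c *\<^sub>C w))"
      unfolding \<phi>[symmetric] by (rule complex_Re_le_cmod)
    also have "\<dots> = cmod (blinfun_apply \<phi> w)"
      by (simp add: state_scaleC st norm_mult c)
    finally show ?thesis .
  qed
  \<comment> \<open>The state \<open>\<phi>\<close> itself shows that the supremum is over a
    nonempty set.\<close>
  then have "numerical_radius w \<le> cmod (blinfun_apply \<phi> w)"
    unfolding numerical_radius_def using st by (intro cSUP_least) auto
  with pure cmod_state_le_numerical_radius[OF st] that show ?thesis
    by (meson antisym)
qed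

section \<open>Numerical radius parallelism\<close>

lemma numerical_radius_nonneg: "0 \<le> numerical_radius x"
  using pure_state_attains_numerical_radius[of x] by (metis norm_ge_zero)

text \<open>If \<open>d\<close> and \<open>e\<close> rotate \<open>a\<close> and \<open>b\<close>
  onto the nonnegative real axis, then \<open>e / d\<close> gives \<open>b\<close> the phase of
  \<open>a\<close>.\<close>

lemma ex_unimodular_norm_add_eq: "\<exists>c. cmod c = 1 \<and> cmod (a + c * b) = cmod a + cmod b"
proof -
  obtain d e where d: "cmod d = 1" "d * a = of_real (cmod a)"
    and e: "cmod e = 1" "e * b = of_real (cmod b)"
    using unimodular_rotation by metis
  have "d \<noteq> 0" using d by auto
  have "cmod (a + e / d * b) = cmod (d * (a + e / d * b))"
    by (simp add: norm_mult d(1))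
  also have "d * (a + e / d * b) = of_real (cmod a + cmod b)"
    using \<open>d \<noteq> 0\<close> by (simp add: distrib_left d(2) e(2))
  also have "cmod \<dots> = cmod a + cmod b"
    by (simp only: norm_of_real) simp
  finally show ?thesis
    using d(1) e(1) by (intro exI[of _ "e / d"]) (simp add: norm_divide)
qed

text \<open>A pure state attaining the radius of \<open>x + c *\<^sub>C y\<close> turns the triangle
  inequality and both radius bounds into equalities. Conversely, \<open>c\<close> aligns the phases
  of the two values of the given state.\<close>

lemma parallel_iff_pure_state_attains_both:
  fixes x y :: "'a::unital_cstar_algebra"
  shows "x \<parallel>\<^sub>v y \<longleftrightarrow> (\<exists>\<phi>. pure_state \<phi> \<and> cmod (blinfun_apply \<phi> x) = numerical_radius x \<and>
    cmod (blinfun_apply \<phi> y) = numerical_radius y)"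
    (is "_ \<longleftrightarrow> (\<exists>\<phi>. ?both \<phi>)")
proof -
  have stD: "\<phi> \<in> states" if "pure_state \<phi>" for \<phi> :: "'a \<Rightarrow>\<^sub>L complex"
    using that by (simp add: pure_state_def extreme_point_of_def)
  have app: "blinfun_apply \<phi> (x + c *\<^sub>C y) = blinfun_apply \<phi> x + c * blinfun_apply \<phi> y"
    if "\<phi> \<in> states" for \<phi> c
    by (simp add: blinfun.add_right state_scaleC that)
  have tri: "cmod (blinfun_apply \<phi> (x + c *\<^sub>C y)) \<le> cmod (blinfun_apply \<phi> x) + cmod (blinfun_apply \<phi> y)"
    if "\<phi> \<in> states" "cmod c = 1" for \<phi> c
    using norm_triangle_ineq[of "blinfun_apply \<phi> x" "c * blinfun_apply \<phi> y"] that
    by (simp add: app norm_mult)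
  show ?thesis
  proof
    assume "x \<parallel>\<^sub>v y"
    then obtain c where c: "cmod c = 1"
      and eq: "numerical_radius (x + c *\<^sub>C y) = numerical_radius x + numerical_radius y"
      by (auto simp: numerical_radius_parallel_def)
    obtain \<phi> where \<phi>: "pure_state \<phi>"
      "cmod (blinfun_apply \<phi> (x + c *\<^sub>C y)) = numerical_radius (x + c *\<^sub>C y)"
      by (rule pure_state_attains_numerical_radius)
    have "?both \<phi>"
      using tri[OF stD[OF \<phi>(1)] c] \<phi> eq
        cmod_state_le_numerical_radius[OF stD[OF \<phi>(1)], of x]
        cmod_state_le_numerical_radius[OF stD[OF \<phi>(1)], of y] by linarith
    then show "\<exists>\<phi>. ?both \<phi>" by blast
  next
    assume "\<exists>\<phi>. ?both \<phi>"
    then obtain \<phi> where \<phi>: "?both \<phi>" by blast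
    then have st: "\<phi> \<in> states" by (blast intro: stD)
    obtain c where c: "cmod c = 1" "cmod (blinfun_apply \<phi> x + c * blinfun_apply \<phi> y) =
        cmod (blinfun_apply \<phi> x) + cmod (blinfun_apply \<phi> y)"
      using ex_unimodular_norm_add_eq by blast
    have "numerical_radius x + numerical_radius y \<le> numerical_radius (x + c *\<^sub>C y)"
      using cmod_state_le_numerical_radius[OF st, of "x + c *\<^sub>C y"] c(2) \<phi> by (simp add: app[OF st])
    \<comment> \<open>The upper bound is subadditivity of the numerical radius, read off at a state
      attaining the left-hand side.\<close>
    moreover obtain \<psi> where \<psi>: "pure_state \<psi>"
      "cmod (blinfun_apply \<psi> (x + c *\<^sub>C y)) = numerical_radius (x + c *\<^sub>C y)"
      by (rule pure_state_attains_numerical_radius)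
    then have "numerical_radius (x + c *\<^sub>C y) \<le> numerical_radius x + numerical_radius y"
      using tri[OF stD[OF \<psi>(1)] c(1)]
        cmod_state_le_numerical_radius[OF stD[OF \<psi>(1)], of x]
        cmod_state_le_numerical_radius[OF stD[OF \<psi>(1)], of y] by linarith
    ultimately show "x \<parallel>\<^sub>v y"
      using c(1) unfolding numerical_radius_parallel_def by (blast intro: antisym)
  qed
qed

theorem theorem2p13:
  fixes x y :: "'a::unital_cstar_algebra"
  shows "x \<parallel>\<^sub>v y \<longleftrightarrow>
    (\<exists>\<phi> :: 'a \<Rightarrow>\<^sub>L complex. pure_state \<phi> \<and>
      cmod (blinfun_apply \<phi> x * blinfun_apply \<phi> y) = numerical_radius x * numerical_radius y)"
proof
  assume "x \<parallel>\<^sub>v y"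
  then show "\<exists>\<phi> :: 'a \<Rightarrow>\<^sub>L complex. pure_state \<phi> \<and>
      cmod (blinfun_apply \<phi> x * blinfun_apply \<phi> y) = numerical_radius x * numerical_radius y"
    unfolding parallel_iff_pure_state_attains_both by (auto simp: norm_mult)
next
  assume "\<exists>\<phi> :: 'a \<Rightarrow>\<^sub>L complex. pure_state \<phi> \<and>
      cmod (blinfun_apply \<phi> x * blinfun_apply \<phi> y) = numerical_radius x * numerical_radius y"
  then obtain \<phi> :: "'a \<Rightarrow>\<^sub>L complex" where pure: "pure_state \<phi>"
    and prod: "cmod (blinfun_apply \<phi> x) * cmod (blinfun_apply \<phi> y) =
      numerical_radius x * numerical_radius y"
    by (auto simp: norm_mult)
  have le: "cmod (blinfun_apply \<psi> a) \<le> numerical_radius a" if "pure_state \<psi>" for \<psi> and a :: 'a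
    using that by (intro cmod_state_le_numerical_radius) (simp add: pure_state_def extreme_point_of_def)
  have zero: "cmod (blinfun_apply \<psi> a) = 0" if "pure_state \<psi>" "numerical_radius a = 0"
    for \<psi> and a :: 'a
    using le[OF that(1), of a] that(2) by simp
  \<comment> \<open>If one radius vanishes, the product equation does not force
    \<open>\<phi>\<close> to attain the other. It is then replaced by a pure state that does; every
    pure state attains a zero radius.\<close>
  consider "numerical_radius x = 0" | "numerical_radius y = 0"
    | "numerical_radius x > 0" "numerical_radius y > 0"
    using numerical_radius_nonneg[of x] numerical_radius_nonneg[of y] by linarith
  then show "x \<parallel>\<^sub>v y"
    unfolding parallel_iff_pure_state_attains_both
  proof cases
    case 1
    then show "\<exists>\<phi>. pure_state \<phi> \<and> cmod (blinfun_apply \<phi> x) = numerical_radius x \<and>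
        cmod (blinfun_apply \<phi> y) = numerical_radius y"
      using pure_state_attains_numerical_radius[of y] zero by metis
  next
    case 2
    then show "\<exists>\<phi>. pure_state \<phi> \<and> cmod (blinfun_apply \<phi> x) = numerical_radius x \<and>
        cmod (blinfun_apply \<phi> y) = numerical_radius y"
      using pure_state_attains_numerical_radius[of x] zero by metis
  next
    case 3
    have "cmod (blinfun_apply \<phi> x) = numerical_radius x"
    \<comment> \<open>The positive factor \<open>numerical_radius y\<close> is cancelled; the
      equality for \<open>y\<close> then follows from \<open>prod\<close> by cancelling
      \<open>numerical_radius x\<close>.\<close>
    proof (rule antisym[OF le[OF pure]], rule mult_right_le_imp_le[OF _ 3(2)])
      have "cmod (blinfun_apply \<phi> x) * cmod (blinfun_apply \<phi> y) \<le>
          cmod (blinfun_apply \<phi> x) * numerical_radius y"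
        by (intro mult_left_mono le pure) simp
      with prod show "numerical_radius x * numerical_radius y \<le>
          cmod (blinfun_apply \<phi> x) * numerical_radius y" by simp
    qed
    with prod 3 pure show "\<exists>\<phi>. pure_state \<phi> \<and> cmod (blinfun_apply \<phi> x) = numerical_radius x \<and>
        cmod (blinfun_apply \<phi> y) = numerical_radius y"
      by auto
  qed
qed

end
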